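(* Let $P$ be a point that does not lie on the extended sides of triangle $ABC$ or of its anticomplementary triangle. (a) The triangles $A_3B_3C_3$ and $A'_3B'_3C'_3$ are always congruent to each other. (b) If $P$ and $P'$ are ordinary, the length $|T_P(P')P|$ of the segment $T_P(P')P$ is equal to $$\frac{|QQ'|\,|XP|}{|XQ'|}.$$
   Context: Work in the extended Euclidean plane: the Euclidean plane together with the line at infinity $l_\infty$. Points on $l_\infty$ are called infinite, all other points ordinary; affine maps are extended to $l_\infty$. $XY$ denotes the line through $X$ and $Y$, $|XY|$ the length of the segment $XY$, and $l\cdot m$ the intersection point of lines $l$ and $m$. $ABC$ is a (nondegenerate) triangle with centroid $G$. $K$ is the homothety with center $G$ and ratio $-1/2$; the anticomplementary triangle is $K^{-1}(ABC)$. $D=AP\cdot BC$, $E=BP\cdot CA$, $F=CP\cdot AB$ are the traces of $P$, and $D_3,E_3,F_3$ are their reflections in the midpoints of $BC,CA,AB$ respectively; the lines $AD_3,BE_3,CF_3$ meet in the isotomic conjugate $P'$ of $P$. Put $Q=K(P')$, $Q'=K(P)$. $T_P$ is the unique affine map with $A\mapsto D$, $B\mapsto E$, $C\mapsto F$; $T_{P'}$ is the unique affine map with $A\mapsto D_3$, $B\mapsto E_3$, $C\mapsto F_3$. $A_3B_3C_3=T_P(D_3E_3F_3)$ and $A'_3B'_3C'_3=T_{P'}(DEF)$ (vertices corresponding in order). $X=AA_3\cdot BB_3$, which is the fixed point of the map $\mathcal{S}_1=T_P\circ T_{P'}$. *)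

theory Defs
  imports "HOL-Analysis.Analysis"
begin

text \<open>
  The extended Euclidean plane. A point at infinity is a direction, i.e. a line through the
  origin of \<open>real^2\<close>.
\<close>

typedef direction = "{L :: (real^2) set. subspace L \<and> dim L = 1}"
proof
  show "span {axis 1 1 :: real^2} \<in> {L. subspace L \<and> dim L = 1}"
    by (simp add: dim_span_eq_card_independent axis_eq_0_iff)
qed

datatype point = Ordinary "real^2" | Infinite direction

definition is_ordinary :: "point \<Rightarrow> bool" where
  "is_ordinary X \<longleftrightarrow> (\<exists>x. X = Ordinary x)"

definition line_at_infinity :: "point set" where
  "line_at_infinity = range Infinite"

definition ordinary_line :: "real^2 \<Rightarrow> direction \<Rightarrow> point set" where
  "ordinary_line a d = insert (Infinite d) (Ordinary ` ((+) a ` Rep_direction d))"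

definition is_line :: "point set \<Rightarrow> bool" where
  "is_line l \<longleftrightarrow> l = line_at_infinity \<or> (\<exists>a d. l = ordinary_line a d)"

text \<open>Meaningful only for \<open>X \<noteq> Y\<close> and \<open>l \<noteq> m\<close> respectively; unspecified otherwise.\<close>

definition join :: "point \<Rightarrow> point \<Rightarrow> point set" where
  "join X Y = (THE l. is_line l \<and> X \<in> l \<and> Y \<in> l)"

definition meet :: "point set \<Rightarrow> point set \<Rightarrow> point" where
  "meet l m = (THE Z. Z \<in> l \<and> Z \<in> m)"

text \<open>Length of a segment with ordinary endpoints; unspecified if an endpoint is infinite.\<close>

fun seg_length :: "point \<Rightarrow> point \<Rightarrow> real" where
  "seg_length (Ordinary x) (Ordinary y) = dist x y"

text \<open>
  Extension of an affine map to the line at infinity: \<open>v \<mapsto> f v - f 0\<close> is the linear part of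
  \<open>f\<close>. Only meaningful for bijective affine \<open>f\<close>.
\<close>

primrec extend :: "(real^2 \<Rightarrow> real^2) \<Rightarrow> point \<Rightarrow> point" where
  "extend f (Ordinary x) = Ordinary (f x)"
| "extend f (Infinite d) = Infinite (Abs_direction ((\<lambda>v. f v - f 0) ` Rep_direction d))"

definition is_affine_map :: "(point \<Rightarrow> point) \<Rightarrow> bool" where
  "is_affine_map T \<longleftrightarrow> (\<exists>h c. linear h \<and> bij h \<and> T = extend (\<lambda>x. h x + c))"

definition affine_map_taking ::
    "point \<times> point \<times> point \<Rightarrow> point \<times> point \<times> point \<Rightarrow> point \<Rightarrow> point" where
  "affine_map_taking = (\<lambda>(X, Y, Z) (X', Y', Z').
     THE T. is_affine_map T \<and> T X = X' \<and> T Y = Y' \<and> T Z = Z')"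

definition homothety :: "real^2 \<Rightarrow> real \<Rightarrow> point \<Rightarrow> point" where
  "homothety c k = extend (\<lambda>x. c + k *\<^sub>R (x - c))"

definition reflection_in :: "real^2 \<Rightarrow> point \<Rightarrow> point" where
  "reflection_in m = extend (\<lambda>x. 2 *\<^sub>R m - x)"

text \<open>Congruence of nondegenerate triangles, with vertices corresponding in order.\<close>

definition congruent_triangles ::
    "point \<times> point \<times> point \<Rightarrow> point \<times> point \<times> point \<Rightarrow> bool" where
  "congruent_triangles S T \<longleftrightarrow>
     (\<exists>x y z g. \<not> collinear {x, y, z} \<and>
        (\<forall>u v :: real^2. dist (g u :: real^2) (g v) = dist u v) \<and>
        S = (Ordinary x, Ordinary y, Ordinary z) \<and>
        T = (Ordinary (g x), Ordinary (g y), Ordinary (g z)))"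

text \<open>
  Below, \<open>A B C\<close> is the reference triangle and \<open>P\<close> a point of the extended plane. A function
  attached to the vertex \<open>A\<close> gives the corresponding object at \<open>B\<close> or \<open>C\<close> when the arguments
  \<open>A B C\<close> are permuted cyclically.
\<close>

definition centroid :: "real^2 \<Rightarrow> real^2 \<Rightarrow> real^2 \<Rightarrow> real^2" where
  "centroid A B C = (1/3) *\<^sub>R (A + B + C)"

definition complement_map :: "real^2 \<Rightarrow> real^2 \<Rightarrow> real^2 \<Rightarrow> point \<Rightarrow> point" where
  "complement_map A B C = homothety (centroid A B C) (- 1/2)"

definition side_lines :: "point \<Rightarrow> point \<Rightarrow> point \<Rightarrow> point set" where
  "side_lines X Y Z = join Y Z \<union> join Z X \<union> join X Y"

definition anticomplementary_vertex :: "real^2 \<Rightarrow> real^2 \<Rightarrow> real^2 \<Rightarrow> real^2 \<Rightarrow> point" where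
  "anticomplementary_vertex A B C V = inv (complement_map A B C) (Ordinary V)"

definition cevian_trace :: "real^2 \<Rightarrow> real^2 \<Rightarrow> real^2 \<Rightarrow> point \<Rightarrow> point" where
  "cevian_trace A B C P = meet (join (Ordinary A) P) (join (Ordinary B) (Ordinary C))"

definition reflected_trace :: "real^2 \<Rightarrow> real^2 \<Rightarrow> real^2 \<Rightarrow> point \<Rightarrow> point" where
  "reflected_trace A B C P = reflection_in (midpoint B C) (cevian_trace A B C P)"

definition isotomic_conjugate :: "real^2 \<Rightarrow> real^2 \<Rightarrow> real^2 \<Rightarrow> point \<Rightarrow> point" where
  "isotomic_conjugate A B C P =
     (THE Z. Z \<in> join (Ordinary A) (reflected_trace A B C P) \<and>
             Z \<in> join (Ordinary B) (reflected_trace B C A P) \<and>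
             Z \<in> join (Ordinary C) (reflected_trace C A B P))"

text \<open>The maps \<open>T\<^sub>P\<close> and \<open>T\<^sub>P\<^sub>'\<close>, the latter defined from \<open>P\<close>.\<close>

definition T_map :: "real^2 \<Rightarrow> real^2 \<Rightarrow> real^2 \<Rightarrow> point \<Rightarrow> point \<Rightarrow> point" where
  "T_map A B C P = affine_map_taking (Ordinary A, Ordinary B, Ordinary C)
     (cevian_trace A B C P, cevian_trace B C A P, cevian_trace C A B P)"

definition T'_map :: "real^2 \<Rightarrow> real^2 \<Rightarrow> real^2 \<Rightarrow> point \<Rightarrow> point \<Rightarrow> point" where
  "T'_map A B C P = affine_map_taking (Ordinary A, Ordinary B, Ordinary C)
     (reflected_trace A B C P, reflected_trace B C A P, reflected_trace C A B P)"

definition X_point :: "real^2 \<Rightarrow> real^2 \<Rightarrow> real^2 \<Rightarrow> point \<Rightarrow> point" where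
  "X_point A B C P =
     meet (join (Ordinary A) (T_map A B C P (reflected_trace A B C P)))
          (join (Ordinary B) (T_map A B C P (reflected_trace B C A P)))"

end

theory Submission
  imports Defs
begin

text \<open>
  Everything is computed in homogeneous barycentric coordinates with respect to \<open>A\<close>, \<open>B\<close>, \<open>C\<close>,
  which treat ordinary and infinite points alike. Let \<open>P = (p : q : r)\<close>. Avoiding the sides means
  \<open>p, q, r \<noteq> 0\<close>, and avoiding the sides of the anticomplementary triangle means
  \<open>q + r, r + p, p + q \<noteq> 0\<close>. Hence all six points \<open>D = (0 : q : r)\<close>, \<open>D\<^sub>3 = (0 : r : q)\<close>, \<open>\<dots>\<close> are
  ordinary, the triangles \<open>DEF\<close> and \<open>D\<^sub>3E\<^sub>3F\<^sub>3\<close> are nondegenerate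
  (\<open>inscribed_triangle_not_collinear\<close>), and \<open>P' = (qr : rp : pq)\<close>
  (\<open>isotomic_conjugate_bary_point\<close>). An affine map preserves barycentric coordinates
  (\<open>affine_map_taking_bary_point\<close>), so images under \<open>T\<^sub>P\<close> and \<open>T\<^sub>P\<^sub>'\<close> can be read off directly.

  (a) The two triangles are \<open>T\<^sub>P T\<^sub>P\<^sub>'(ABC)\<close> and \<open>T\<^sub>P\<^sub>' T\<^sub>P(ABC)\<close>. The linear parts of \<open>T\<^sub>P\<close> and \<open>T\<^sub>P\<^sub>'\<close>
  commute, so the two composites differ by a translation. In coordinates: the vector
  \<open>A\<^sub>3' - A\<^sub>3\<close> is invariant under cyclic permutation of \<open>(A, p), (B, q), (C, r)\<close>
  (\<open>reflected_image_eq_shift\<close>), so it is the same at all three vertices.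

  (b) Normalise \<open>p + q + r = 1\<close> and put \<open>\<Pi> = (q + r)(r + p)(p + q)\<close>. Then
  \<open>T\<^sub>P(P') - P = (pqr / \<Pi>) (P - P')\<close> (\<open>T_image_displacement\<close>), whereas \<open>Q - Q' = (P - P') / 2\<close>
  because the complement map has ratio \<open>- 1/2\<close>. On the other hand
  \<open>X = (p\<^sup>2(q + r) : q\<^sup>2(r + p) : r\<^sup>2(p + q))\<close> lies on the line \<open>PG\<close>, which also contains \<open>Q'\<close>: with \<open>N\<close>
  the coordinate sum of \<open>X\<close>, \<open>X - P = (3pqr / N) (P - G)\<close> and \<open>X - Q' = (3\<Pi> / 2N) (P - G)\<close>
  (\<open>X_displacement\<close>). So \<open>|XP| / |XQ'|\<close> and \<open>|T\<^sub>P(P')P| / |QQ'|\<close> have the same value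
  \<open>|2pqr / \<Pi>|\<close>. If \<open>X\<close> is infinite then \<open>N = \<Pi> - 2pqr\<close> vanishes and this value is \<open>1\<close>. If \<open>P = G\<close>,
  the quotient is \<open>0 / 0 = 0\<close>, but then also \<open>P' = G\<close> and both sides of the formula are \<open>0\<close>.
\<close>

section \<open>Linear algebra in the plane\<close>

definition wedge :: "real^2 \<Rightarrow> real^2 \<Rightarrow> real" where
  "wedge u v = u$1 * v$2 - u$2 * v$1"

lemma wedge_eq_0_iff: "wedge u v = 0 \<longleftrightarrow> u = 0 \<or> (\<exists>c. v = c *\<^sub>R u)"
proof
  assume w: "wedge u v = 0"
  show "u = 0 \<or> (\<exists>c. v = c *\<^sub>R u)"
  proof (cases "u = 0")
    case False
    then consider "u$1 \<noteq> 0" | "u$2 \<noteq> 0"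
      by (auto simp: vec_eq_iff forall_2)
    then show ?thesis
    proof cases
      case 1
      then have "v = (v$1 / u$1) *\<^sub>R u"
        using w by (simp add: wedge_def vec_eq_iff forall_2 field_simps)
      then show ?thesis by blast
    next
      case 2
      then have "v = (v$2 / u$2) *\<^sub>R u"
        using w by (simp add: wedge_def vec_eq_iff forall_2 field_simps)
      then show ?thesis by blast
    qed
  qed simp
qed (auto simp: wedge_def)

lemma collinear_iff_wedge: "collinear {A, B, C} \<longleftrightarrow> wedge (B - A) (C - A) = 0"
proof -
  have "collinear {A, B, C} \<longleftrightarrow> collinear {0, B - A, C - A}"
    using collinear_3[of B A C] by (simp add: insert_commute)
  also have "\<dots> \<longleftrightarrow> B - A = 0 \<or> (\<exists>c. C - A = c *\<^sub>R (B - A))"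
    using collinear_lemma[of "B - A" "C - A"] by (metis scaleR_zero_left)
  finally show ?thesis
    by (simp add: wedge_eq_0_iff)
qed

lemma wedge_combination:
  "wedge (a *\<^sub>R u + b *\<^sub>R v) (c *\<^sub>R u + d *\<^sub>R v) = (a * d - b * c) * wedge u v"
  by (simp add: wedge_def algebra_simps)

lemma span_of_wedge_nonzero:
  assumes "wedge u v \<noteq> 0"
  obtains y z where "w = y *\<^sub>R u + z *\<^sub>R v"
proof
  show "w = (wedge w v / wedge u v) *\<^sub>R u + (wedge u w / wedge u v) *\<^sub>R v"
    using assms unfolding wedge_def
    by (simp add: vec_eq_iff forall_2 divide_simps) (simp add: algebra_simps)
qed

lemma combination_eq_iff:
  assumes "wedge u v \<noteq> 0"
  shows "y *\<^sub>R u + z *\<^sub>R v = y' *\<^sub>R u + z' *\<^sub>R v \<longleftrightarrow> y = y' \<and> z = z'"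
proof
  assume eq: "y *\<^sub>R u + z *\<^sub>R v = y' *\<^sub>R u + z' *\<^sub>R v"
  have "y * wedge u v = y' * wedge u v" "z * wedge u v = z' * wedge u v"
    using arg_cong[OF eq, of "\<lambda>w. wedge w v"] arg_cong[OF eq, of "wedge u"]
    by (simp_all add: wedge_def algebra_simps)
  then show "y = y' \<and> z = z'" using assms by simp
qed simp

lemma combination_eq_0_iff:
  assumes "wedge u v \<noteq> 0"
  shows "y *\<^sub>R u + z *\<^sub>R v = 0 \<longleftrightarrow> y = 0 \<and> z = 0"
  using combination_eq_iff[OF assms, of y z 0 0] by simp

section \<open>Directions and lines\<close>

definition direction_of :: "real^2 \<Rightarrow> direction" where
  "direction_of v = Abs_direction (span {v})"

lemma Rep_direction_of: "v \<noteq> 0 \<Longrightarrow> Rep_direction (direction_of v) = span {v}"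
  unfolding direction_of_def
  by (subst Abs_direction_inverse) (simp_all add: dim_span_eq_card_independent)

text \<open>
  Every point at infinity is given by a nonzero vector, so that membership in lines becomes a
  proportionality of vectors.
\<close>

lemma direction_cases:
  obtains v where "v \<noteq> 0" "d = direction_of v"
proof -
  let ?L = "Rep_direction d"
  have L: "subspace ?L" "dim ?L = 1"
    using Rep_direction[of d] by auto
  obtain v where v: "v \<in> ?L" "v \<noteq> 0"
  proof -
    have "\<not> ?L \<subseteq> {0}"
      using L(2) dim_eq_0[of ?L] by simp
    then show thesis using that by blast
  qed
  have "span {v} = ?L"
  proof (rule subspace_dim_equal)
    show "span {v} \<subseteq> ?L"
      using v(1) L(1) by (simp add: span_minimal)
    show "dim ?L \<le> dim (span {v})"
      using v(2) L(2) by (simp add: dim_span_eq_card_independent)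
  qed (use L in auto)
  then have "d = direction_of v"
    by (simp add: direction_of_def Rep_direction_inverse)
  then show thesis using v(2) that by blast
qed

lemma direction_of_eqI:
  assumes "w = t *\<^sub>R v" "w \<noteq> 0"
  shows "direction_of w = direction_of v"
proof -
  have "v = (1 / t) *\<^sub>R w" using assms by auto
  then have "span {w} = span {v}"
    using assms(1) span_scale[OF span_base, of w "{w}" "1 / t"] span_scale[OF span_base, of v "{v}" t]
    unfolding span_eq by simp
  then show ?thesis by (simp add: direction_of_def)
qed

lemma direction_of_eqD:
  assumes "direction_of w = direction_of v" "v \<noteq> 0" "w \<noteq> 0"
  shows "\<exists>t. w = t *\<^sub>R v"
proof -
  have "span {w} = span {v}"
    using assms Rep_direction_of by metis
  then have "w \<in> span {v}" using span_base[of w "{w}"] by simp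
  then show ?thesis by (auto simp: span_singleton)
qed

definition line_along :: "real^2 \<Rightarrow> real^2 \<Rightarrow> point set" where
  "line_along a v = ordinary_line a (direction_of v)"

lemma is_line_line_along: "is_line (line_along a v)"
  unfolding is_line_def line_along_def by blast

lemma Ordinary_in_line_along:
  "v \<noteq> 0 \<Longrightarrow> Ordinary x \<in> line_along a v \<longleftrightarrow> (\<exists>t. x = a + t *\<^sub>R v)"
  by (auto simp: line_along_def ordinary_line_def Rep_direction_of span_singleton image_iff)

lemma Infinite_in_line_along:
  assumes "v \<noteq> 0" "w \<noteq> 0"
  shows "Infinite (direction_of w) \<in> line_along a v \<longleftrightarrow> (\<exists>t. w = t *\<^sub>R v)"
  using direction_of_eqI[of w _ v] direction_of_eqD[of w v] assms
  by (auto simp: line_along_def ordinary_line_def)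

lemma line_along_move:
  assumes "Ordinary x \<in> line_along a v" "v \<noteq> 0"
  shows "line_along x v = line_along a v"
proof -
  obtain s where s: "x = a + s *\<^sub>R v"
    using assms Ordinary_in_line_along by blast
  have *: "(\<exists>t. y = x + t *\<^sub>R v) \<longleftrightarrow> (\<exists>t. y = a + t *\<^sub>R v)" for y
  proof
    assume "\<exists>t. y = x + t *\<^sub>R v"
    then obtain t where "y = a + (s + t) *\<^sub>R v"
      using s by (auto simp: algebra_simps)
    then show "\<exists>t. y = a + t *\<^sub>R v" by blast
  next
    assume "\<exists>t. y = a + t *\<^sub>R v"
    then obtain t where "y = x + (t - s) *\<^sub>R v"
      using s by (auto simp: algebra_simps)
    then show "\<exists>t. y = x + t *\<^sub>R v" by blast
  qed
  have "(+) c ` span {v} = {y. \<exists>t. y = c + t *\<^sub>R v}" for c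
    by (auto simp: span_singleton)
  then have "(+) x ` span {v} = (+) a ` span {v}"
    using * by simp
  then show ?thesis
    using assms(2) by (simp add: line_along_def ordinary_line_def Rep_direction_of)
qed

lemma is_line_cases:
  assumes "is_line l"
  obtains "l = line_at_infinity" | a v where "v \<noteq> 0" "l = line_along a v"
  using assms direction_cases unfolding is_line_def line_along_def by metis

lemma line_through_ordinary_points:
  assumes "is_line l" "Ordinary x \<in> l" "Ordinary y \<in> l" "x \<noteq> y"
  shows "l = line_along x (y - x)"
  using assms(1)
proof (cases rule: is_line_cases)
  case 1
  then show ?thesis using assms(2) by (auto simp: line_at_infinity_def)
next
  case (2 a v)
  then have l: "l = line_along x v"
    using line_along_move assms(2) by metis
  then obtain t where "y = x + t *\<^sub>R v"
    using assms(3) 2(1) Ordinary_in_line_along by blast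
  then have "direction_of (y - x) = direction_of v"
    using assms(4) by (intro direction_of_eqI[of _ t]) auto
  then show ?thesis using l by (simp add: line_along_def)
qed

lemma line_through_ordinary_infinite:
  assumes "is_line l" "Ordinary x \<in> l" "Infinite d \<in> l"
  shows "l = ordinary_line x d"
  using assms(1)
proof (cases rule: is_line_cases)
  case 1
  then show ?thesis using assms(2) by (auto simp: line_at_infinity_def)
next
  case (2 a v)
  then have l: "l = line_along x v"
    using line_along_move assms(2) by metis
  then show ?thesis using assms(3) by (auto simp: line_along_def ordinary_line_def)
qed

text \<open>
  The incidence axiom on which all joins and intersections below rest: it turns the definite
  descriptions in \<open>join\<close> and \<open>meet\<close> into computations.
\<close>

lemma line_unique:
  assumes "is_line l" "is_line m" "X \<noteq> Y" "X \<in> l" "Y \<in> l" "X \<in> m" "Y \<in> m"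
  shows "l = m"
proof (cases X; cases Y)
  fix x y assume "X = Ordinary x" "Y = Ordinary y"
  then show ?thesis using assms(3) line_through_ordinary_points[OF assms(1), of x y]
      line_through_ordinary_points[OF assms(2), of x y] assms(4-) by simp
next
  fix x d assume "X = Ordinary x" "Y = Infinite d"
  then show ?thesis using line_through_ordinary_infinite[OF assms(1), of x d]
      line_through_ordinary_infinite[OF assms(2), of x d] assms(4-) by simp
next
  fix d y assume "X = Infinite d" "Y = Ordinary y"
  then show ?thesis using line_through_ordinary_infinite[OF assms(1), of y d]
      line_through_ordinary_infinite[OF assms(2), of y d] assms(4-) by simp
next
  fix d e assume XY: "X = Infinite d" "Y = Infinite e"
  have "k = line_at_infinity" if "is_line k" "X \<in> k" "Y \<in> k" for k
    using that assms(3) XY by (auto simp: is_line_def ordinary_line_def)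
  then show ?thesis using assms by metis
qed

lemma join_eqI:
  assumes "is_line l" "X \<in> l" "Y \<in> l" "X \<noteq> Y"
  shows "join X Y = l"
  unfolding join_def using assms line_unique by (intro the_equality) blast+

lemma meet_eqI:
  assumes "is_line l" "is_line m" "l \<noteq> m" "Z \<in> l" "Z \<in> m"
  shows "meet l m = Z"
  unfolding meet_def using assms line_unique by (intro the_equality) blast+

section \<open>Barycentric coordinates\<close>

text \<open>
  The weights are homogeneous. If they sum to \<open>0\<close>, the combination of position vectors does not
  depend on the origin and gives the direction of an infinite point. Only weights that do not all
  vanish are meaningful.
\<close>

definition bary_point :: "real^2 \<Rightarrow> real^2 \<Rightarrow> real^2 \<Rightarrow> real \<Rightarrow> real \<Rightarrow> real \<Rightarrow> point" where
  "bary_point A B C p q r =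
     (if p + q + r = 0 then Infinite (direction_of (p *\<^sub>R A + q *\<^sub>R B + r *\<^sub>R C))
      else Ordinary ((1 / (p + q + r)) *\<^sub>R (p *\<^sub>R A + q *\<^sub>R B + r *\<^sub>R C)))"

lemma bary_point_cycle: "bary_point A B C p q r = bary_point B C A q r p"
  by (simp add: bary_point_def add_ac)

lemma bary_sum_eq:
  "p *\<^sub>R A + q *\<^sub>R B + r *\<^sub>R C
   = (p + q + r) *\<^sub>R A + (q *\<^sub>R (B - A) + r *\<^sub>R (C - A))" for A :: "real^2"
  by (simp add: algebra_simps)

lemma bary_point_scale:
  assumes "k \<noteq> 0" "p *\<^sub>R A + q *\<^sub>R B + r *\<^sub>R C \<noteq> 0 \<or> p + q + r \<noteq> 0"
  shows "bary_point A B C (k * p) (k * q) (k * r) = bary_point A B C p q r"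
proof -
  have s: "k * p + k * q + k * r = k * (p + q + r)" by (simp add: algebra_simps)
  have v: "(k * p) *\<^sub>R A + (k * q) *\<^sub>R B + (k * r) *\<^sub>R C
    = k *\<^sub>R (p *\<^sub>R A + q *\<^sub>R B + r *\<^sub>R C)"
    by (simp add: scaleR_right_distrib)
  show ?thesis
    using assms direction_of_eqI[OF v[unfolded v]]
    unfolding bary_point_def s v by auto
qed

lemma bary_point_exists:
  assumes "\<not> collinear {A, B, C}"
  obtains p q r where "Z = bary_point A B C p q r" "p \<noteq> 0 \<or> q \<noteq> 0 \<or> r \<noteq> 0"
proof -
  have w: "wedge (B - A) (C - A) \<noteq> 0" using assms collinear_iff_wedge by blast
  show thesis
  proof (cases Z)
    case (Ordinary x)
    obtain q r where "x - A = q *\<^sub>R (B - A) + r *\<^sub>R (C - A)"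
      using span_of_wedge_nonzero[OF w] by blast
    then have "Z = bary_point A B C (1 - q - r) q r"
      unfolding bary_point_def Ordinary by (simp add: algebra_simps)
    moreover have "1 - q - r \<noteq> 0 \<or> q \<noteq> 0 \<or> r \<noteq> 0" by auto
    ultimately show thesis using that by blast
  next
    case (Infinite d)
    obtain v where v: "v \<noteq> 0" "d = direction_of v" using direction_cases by blast
    obtain q r where qr: "v = q *\<^sub>R (B - A) + r *\<^sub>R (C - A)"
      using span_of_wedge_nonzero[OF w] by blast
    then have "Z = bary_point A B C (- q - r) q r"
      unfolding bary_point_def bary_sum_eq[of _ A _ B _ C] Infinite v(2) by simp
    moreover have "q \<noteq> 0 \<or> r \<noteq> 0" using qr v(1) by auto
    ultimately show thesis using that by blast
  qed
qed

text \<open>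
  In the affine frame at \<open>A\<close> with axes \<open>B - A\<close> and \<open>C - A\<close> the point has affine coordinates
  \<open>(q / s, r / s)\<close> with \<open>s = p + q + r\<close>, or direction \<open>(q, r)\<close> if \<open>s = 0\<close>. Either way the line through
  \<open>A\<close> with direction \<open>(y, z)\<close> has the equation that \<open>(q, r)\<close> and \<open>(y, z)\<close> are proportional.
  The other two vertices follow by cyclic permutation.
\<close>

lemma bary_point_in_line_along:
  assumes nc: "\<not> collinear {A, B, C}"
    and yz: "y \<noteq> 0 \<or> z \<noteq> 0" and pqr: "p \<noteq> 0 \<or> q \<noteq> 0 \<or> r \<noteq> 0"
  shows "bary_point A B C p q r \<in> line_along A (y *\<^sub>R (B - A) + z *\<^sub>R (C - A)) \<longleftrightarrow> q * z = r * y"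
proof -
  let ?u = "B - A" and ?v = "C - A"
  let ?d = "y *\<^sub>R ?u + z *\<^sub>R ?v" and ?s = "p + q + r"
  have w: "wedge ?u ?v \<noteq> 0" using nc collinear_iff_wedge by blast
  have d: "?d \<noteq> 0" using combination_eq_0_iff[OF w] yz by blast
  have along: "(\<exists>t. b *\<^sub>R ?u + c *\<^sub>R ?v = t *\<^sub>R ?d) \<longleftrightarrow> b * z = c * y" for b c
  proof
    assume "\<exists>t. b *\<^sub>R ?u + c *\<^sub>R ?v = t *\<^sub>R ?d"
    then obtain t where "b *\<^sub>R ?u + c *\<^sub>R ?v = (t * y) *\<^sub>R ?u + (t * z) *\<^sub>R ?v"
      by (auto simp: scaleR_right_distrib)
    then show "b * z = c * y" using combination_eq_iff[OF w] by simp
  next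
    assume bc: "b * z = c * y"
    define t where "t = (if y = 0 then c / z else b / y)"
    have "b = t * y" "c = t * z"
      using bc yz by (auto simp: t_def field_simps)
    then have "b *\<^sub>R ?u + c *\<^sub>R ?v = t *\<^sub>R ?d" by (simp add: scaleR_right_distrib)
    then show "\<exists>t. b *\<^sub>R ?u + c *\<^sub>R ?v = t *\<^sub>R ?d" by blast
  qed
  show ?thesis
  proof (cases "?s = 0")
    case True
    have "q \<noteq> 0 \<or> r \<noteq> 0" using True pqr by auto
    then have "q *\<^sub>R ?u + r *\<^sub>R ?v \<noteq> 0" using combination_eq_0_iff[OF w] by blast
    then show ?thesis
      using along[of q r] Infinite_in_line_along[OF d]
      unfolding bary_point_def bary_sum_eq[of p A q B r C] by (simp add: True)
  next
    case False
    have "(1 / ?s) *\<^sub>R (p *\<^sub>R A + q *\<^sub>R B + r *\<^sub>R C)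
      = A + ((q / ?s) *\<^sub>R ?u + (r / ?s) *\<^sub>R ?v)"
      unfolding bary_sum_eq[of p A q B r C] using False
      by (simp add: scaleR_right_distrib)
    then show ?thesis
      using along[of "q / ?s" "r / ?s"] Ordinary_in_line_along[OF d] False
      unfolding bary_point_def by simp
  qed
qed

lemma bary_point_vertex: "bary_point A B C 1 0 0 = Ordinary A"
  by (simp add: bary_point_def)

section \<open>Traces, cevians and the isotomic conjugate\<close>

text \<open>
  The direction from \<open>A\<close> is determined by the ratio \<open>q : r\<close>, for ordinary and infinite points alike:
  adding a multiple of the vertex \<open>A\<close> moves a point along its line through \<open>A\<close>.
\<close>

lemma join_vertex_bary_point:
  assumes nc: "\<not> collinear {A, B, C}" and qr: "q \<noteq> 0 \<or> r \<noteq> 0"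
  shows "join (Ordinary A) (bary_point A B C p q r)
    = line_along A (q *\<^sub>R (B - A) + r *\<^sub>R (C - A))"
proof (rule join_eqI)
  show "Ordinary A \<noteq> bary_point A B C p q r"
  proof
    assume eq: "Ordinary A = bary_point A B C p q r"
    have "Ordinary A \<in> line_along A (y *\<^sub>R (B - A) + z *\<^sub>R (C - A))" if "y \<noteq> 0 \<or> z \<noteq> 0" for y z
      using bary_point_in_line_along[OF nc that, of 1 0 0] by (simp add: bary_point_vertex)
    then have "q * z = r * y" if "y \<noteq> 0 \<or> z \<noteq> 0" for y z
      using bary_point_in_line_along[OF nc that, of p q r] qr that eq by auto
    from this[of 0 1] this[of 1 0] show False using qr by auto
  qed
  show "Ordinary A \<in> line_along A (q *\<^sub>R (B - A) + r *\<^sub>R (C - A))"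
    using bary_point_in_line_along[OF nc qr, of 1 0 0] by (simp add: bary_point_vertex)
  show "bary_point A B C p q r \<in> line_along A (q *\<^sub>R (B - A) + r *\<^sub>R (C - A))"
    using bary_point_in_line_along[OF nc qr, of p q r] qr by auto
qed (rule is_line_line_along)

lemma not_collinear_cycle: "\<not> collinear {A, B, C} \<Longrightarrow> \<not> collinear {B, C, A}"
  by (simp add: insert_commute)

lemma bary_point_on_side:
  assumes nc: "\<not> collinear {A, B, C}" and pqr: "p \<noteq> 0 \<or> q \<noteq> 0 \<or> r \<noteq> 0"
  shows "bary_point A B C p q r \<in> join (Ordinary B) (Ordinary C) \<longleftrightarrow> p = 0"
proof -
  note nc' = not_collinear_cycle[OF nc]
  have "Ordinary C = bary_point B C A 0 1 0"
    by (simp add: bary_point_def)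
  then have "join (Ordinary B) (Ordinary C) = line_along B (1 *\<^sub>R (C - B) + 0 *\<^sub>R (A - B))"
    using join_vertex_bary_point[OF nc', of 1 0] by simp
  then show ?thesis
    using bary_point_in_line_along[OF nc', of 1 0 q r p] pqr bary_point_cycle[of A B C p q r] by auto
qed

lemma is_line_join_vertices:
  assumes "\<not> collinear {A, B, C}"
  shows "is_line (join (Ordinary B) (Ordinary C))"
proof -
  have "Ordinary C = bary_point B C A 0 1 0"
    by (simp add: bary_point_def)
  then show ?thesis
    using join_vertex_bary_point[OF not_collinear_cycle[OF assms], of 1 0 0] is_line_line_along by simp
qed

lemma cevian_trace_bary_point:
  assumes nc: "\<not> collinear {A, B, C}" and qr: "q \<noteq> 0 \<or> r \<noteq> 0"
  shows "cevian_trace A B C (bary_point A B C p q r) = bary_point A B C 0 q r"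
  unfolding cevian_trace_def
proof (rule meet_eqI)
  note J = join_vertex_bary_point[OF nc qr, of p]
  note L = bary_point_in_line_along[OF nc qr]
  show "is_line (join (Ordinary A) (bary_point A B C p q r))"
    unfolding J by (rule is_line_line_along)
  show "is_line (join (Ordinary B) (Ordinary C))"
    by (rule is_line_join_vertices[OF nc])
  have "Ordinary A \<in> join (Ordinary A) (bary_point A B C p q r)"
    unfolding J using L[of 1 0 0] by (simp add: bary_point_vertex)
  moreover have "Ordinary A \<notin> join (Ordinary B) (Ordinary C)"
    using bary_point_on_side[OF nc, of 1 0 0] by (simp add: bary_point_vertex)
  ultimately show "join (Ordinary A) (bary_point A B C p q r) \<noteq> join (Ordinary B) (Ordinary C)"
    by blast
  show "bary_point A B C 0 q r \<in> join (Ordinary A) (bary_point A B C p q r)"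
    unfolding J using L[of 0 q r] qr by auto
  show "bary_point A B C 0 q r \<in> join (Ordinary B) (Ordinary C)"
    using bary_point_on_side[OF nc, of 0 q r] qr by auto
qed

text \<open>
  A line through \<open>A\<close> fixes the ratio \<open>q : r\<close>, and a line through \<open>B\<close> fixes \<open>p : r\<close>; with \<open>r \<noteq> 0\<close> the two
  ratios determine \<open>(p : q : r)\<close>. This computes both the isotomic conjugate and \<open>X\<close>.
\<close>

lemma cevians_meet_iff:
  assumes nc: "\<not> collinear {A, B, C}" and r: "r \<noteq> 0"
  shows "Z \<in> join (Ordinary A) (bary_point A B C p' q r) \<and> Z \<in> join (Ordinary B) (bary_point A B C p q' r)
    \<longleftrightarrow> Z = bary_point A B C p q r"
proof -
  note nc' = not_collinear_cycle[OF nc]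
  have J: "join (Ordinary A) (bary_point A B C p' q r) = line_along A (q *\<^sub>R (B - A) + r *\<^sub>R (C - A))"
    using join_vertex_bary_point[OF nc] r by blast
  have J': "join (Ordinary B) (bary_point A B C p q' r) = line_along B (r *\<^sub>R (C - B) + p *\<^sub>R (A - B))"
    using join_vertex_bary_point[OF nc', of r p] r bary_point_cycle by metis
  have lines: "is_line (join (Ordinary A) (bary_point A B C p' q r))"
    "is_line (join (Ordinary B) (bary_point A B C p q' r))"
    unfolding J J' by (rule is_line_line_along)+
  have on_A: "bary_point A B C p q r \<in> join (Ordinary A) (bary_point A B C p' q r)"
    unfolding J using bary_point_in_line_along[OF nc, of q r p q r] r by auto
  have on_B: "bary_point A B C p q r \<in> join (Ordinary B) (bary_point A B C p q' r)"
    unfolding J' bary_point_cycle[of A B C p q r]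
    using bary_point_in_line_along[OF nc', of r p q r p] r by auto
  have "Ordinary B \<in> join (Ordinary B) (bary_point A B C p q' r)"
    unfolding J' using bary_point_in_line_along[OF nc', of r p 1 0 0] r by (simp add: bary_point_vertex)
  moreover have "Ordinary B \<notin> join (Ordinary A) (bary_point A B C p' q r)"
    unfolding J using bary_point_in_line_along[OF nc, of q r 0 1 0] r
    by (simp add: bary_point_cycle[of A] bary_point_vertex)
  ultimately have "join (Ordinary A) (bary_point A B C p' q r) \<noteq> join (Ordinary B) (bary_point A B C p q' r)"
    by blast
  then show ?thesis
    using line_unique[OF lines, of Z "bary_point A B C p q r"] on_A on_B by blast
qed

definition weighted_point :: "real^2 \<Rightarrow> real^2 \<Rightarrow> real \<Rightarrow> real \<Rightarrow> real^2" where
  "weighted_point U V m n = (1 / (m + n)) *\<^sub>R (m *\<^sub>R U + n *\<^sub>R V)"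

lemma bary_point_side:
  "q + r \<noteq> 0 \<Longrightarrow> bary_point A B C 0 q r = Ordinary (weighted_point B C q r)"
  by (simp add: bary_point_def weighted_point_def)

lemma cevian_trace_ordinary:
  assumes "\<not> collinear {A, B, C}" "q + r \<noteq> 0"
  shows "cevian_trace A B C (bary_point A B C p q r) = Ordinary (weighted_point B C q r)"
  using cevian_trace_bary_point[of A B C q r p] bary_point_side[of q r A B C] assms by force

lemma reflected_trace_ordinary:
  assumes "\<not> collinear {A, B, C}" "q + r \<noteq> 0"
  shows "reflected_trace A B C (bary_point A B C p q r) = Ordinary (weighted_point B C r q)"
proof -
  have "2 *\<^sub>R midpoint B C - weighted_point B C q r = weighted_point B C r q"
    using assms(2) by (simp add: midpoint_def weighted_point_def vec_eq_iff divide_simps)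
      (simp add: algebra_simps)
  then show ?thesis
    by (simp add: reflected_trace_def cevian_trace_ordinary[OF assms] reflection_in_def)
qed

text \<open>
  Reflection in the midpoint of a side swaps the two weights on that side, and
  \<open>r : q = rp : pq\<close>.
\<close>

lemma isotomic_conjugate_bary_point:
  assumes nc: "\<not> collinear {A, B, C}"
    and nz: "p \<noteq> 0" "q \<noteq> 0" "r \<noteq> 0" "q + r \<noteq> 0" "r + p \<noteq> 0" "p + q \<noteq> 0"
  shows "isotomic_conjugate A B C (bary_point A B C p q r) = bary_point A B C (q * r) (r * p) (p * q)"
proof -
  let ?P = "bary_point A B C p q r" and ?P' = "bary_point A B C (q * r) (r * p) (p * q)"
  have *: "reflected_trace A B C (bary_point A B C p q r) = bary_point A B C 0 (r * p) (p * q)"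
    if "\<not> collinear {A, B, C}" "p \<noteq> 0" "q + r \<noteq> 0" for A B C p q r
  proof -
    have s: "r * p + p * q = p * (q + r)" by (simp add: algebra_simps)
    have "(r * p) *\<^sub>R B + (p * q) *\<^sub>R C = p *\<^sub>R (r *\<^sub>R B + q *\<^sub>R C)"
      by (simp add: algebra_simps)
    then have "weighted_point B C r q = weighted_point B C (r * p) (p * q)"
      using that unfolding weighted_point_def s by (simp add: add.commute)
    moreover have "r * p + p * q \<noteq> 0"
      using that unfolding s by simp
    ultimately show ?thesis
      using reflected_trace_ordinary[of A B C q r p] that bary_point_side by simp
  qed
  note nc2 = not_collinear_cycle[OF nc] and nc3 = not_collinear_cycle[OF not_collinear_cycle[OF nc]]
  have a: "reflected_trace A B C ?P = bary_point A B C 0 (r * p) (p * q)"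
    using *[OF nc] nz by blast
  have b: "reflected_trace B C A ?P = bary_point A B C (q * r) 0 (p * q)"
    using *[OF nc2, of q r p] nz by (metis bary_point_cycle)
  have c: "reflected_trace C A B ?P = bary_point A B C (q * r) (r * p) 0"
    using *[OF nc3, of r p q] nz by (metis bary_point_cycle)
  have pq: "p * q \<noteq> 0" "q * r \<noteq> 0" using nz by simp_all
  have "?P' \<in> join (Ordinary C) (bary_point A B C (q * r) (r * p) 0)"
    using cevians_meet_iff[OF nc3, of "r * p" "bary_point C A B (p * q) (q * r) (r * p)" 0 "q * r" "p * q" 0] nz
    by (simp add: bary_point_cycle[of C A B] bary_point_cycle[of B C A])
  then show ?thesis
    unfolding isotomic_conjugate_def a b c using cevians_meet_iff[OF nc pq(1)]
    by (intro the_equality) blast+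
qed

section \<open>Affine maps of triangles\<close>

text \<open>
  Affine maps respect affine combinations. Uniqueness of the map holds on all of the extended plane,
  because its values at infinity are determined by the underlying map of \<open>real^2\<close>.
\<close>

lemma affine_map_taking_bary_point:
  assumes nc: "\<not> collinear {A, B, C}" and nc': "\<not> collinear {D, E, F}" and s: "p + q + r \<noteq> 0"
  shows "affine_map_taking (Ordinary A, Ordinary B, Ordinary C) (Ordinary D, Ordinary E, Ordinary F)
    (bary_point A B C p q r) = bary_point D E F p q r"
proof -
  let ?u = "B - A" and ?v = "C - A"
  let ?good = "\<lambda>T. is_affine_map T \<and> T (Ordinary A) = Ordinary D \<and> T (Ordinary B) = Ordinary E
    \<and> T (Ordinary C) = Ordinary F"
  have w: "wedge ?u ?v \<noteq> 0" and w': "wedge (E - D) (F - D) \<noteq> 0"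
    using nc nc' collinear_iff_wedge by blast+
  \<comment> \<open>Cramer's rule: the coordinates of \<open>x\<close> in the basis \<open>?u\<close>, \<open>?v\<close> are quotients of wedge products.\<close>
  define h where "h x = (wedge x ?v / wedge ?u ?v) *\<^sub>R (E - D) + (wedge ?u x / wedge ?u ?v) *\<^sub>R (F - D)" for x
  have lin: "linear h"
    unfolding h_def wedge_def
    by (rule linearI) (simp_all add: algebra_simps add_divide_distrib diff_divide_distrib)
  have hu: "h ?u = E - D" and hv: "h ?v = F - D"
    using w by (simp_all add: h_def wedge_def)
  have hcomb: "h (y *\<^sub>R ?u + z *\<^sub>R ?v) = y *\<^sub>R (E - D) + z *\<^sub>R (F - D)" for y z
    using lin hu hv by (simp add: linear_add linear_scale)
  have "x = 0" if "h x = 0" for x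
  proof -
    obtain y z where x: "x = y *\<^sub>R ?u + z *\<^sub>R ?v" using span_of_wedge_nonzero[OF w] by blast
    then show ?thesis using that hcomb combination_eq_0_iff[OF w'] by simp
  qed
  then have inj: "inj h" using lin linear_injective_0 by blast
  then have bij: "bij h" using lin linear_injective_imp_surjective by (auto simp: bij_def)
  define T where "T = extend (\<lambda>x. h x + (D - h A))"
  have "h B + (D - h A) = E" "h C + (D - h A) = F"
    using hu hv lin by (simp_all add: linear_diff algebra_simps)
  then have good: "?good T"
    unfolding is_affine_map_def T_def using lin bij by auto
  have unique: "T' = T" if good': "?good T'" for T'
  proof -
    obtain h' c where h': "linear h'" "T' = extend (\<lambda>x. h' x + c)"
      using good' unfolding is_affine_map_def by blast
    have D: "h' A + c = D" and "h' B + c = E" "h' C + c = F"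
      using good' h'(2) by auto
    then have hu': "h' ?u = E - D" and hv': "h' ?v = F - D"
      using h'(1) by (auto simp: linear_diff)
    have "h' x = h x" for x
    proof -
      obtain y z where x: "x = y *\<^sub>R ?u + z *\<^sub>R ?v" using span_of_wedge_nonzero[OF w] by blast
      then show ?thesis using hcomb h'(1) hu' hv' by (simp add: linear_add linear_scale)
    qed
    then show ?thesis using D unfolding h'(2) T_def by (metis add_diff_cancel_left')
  qed
  have "affine_map_taking (Ordinary A, Ordinary B, Ordinary C) (Ordinary D, Ordinary E, Ordinary F) = T"
    unfolding affine_map_taking_def prod.case using good unique by (intro the_equality) blast+
  moreover have "T (bary_point A B C p q r) = bary_point D E F p q r"
  proof -
    let ?s = "p + q + r"
    have x: "(1 / ?s) *\<^sub>R (p *\<^sub>R A + q *\<^sub>R B + r *\<^sub>R C)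
      = A + ((q / ?s) *\<^sub>R (B - A) + (r / ?s) *\<^sub>R (C - A))" for A B C :: "real^2"
      unfolding bary_sum_eq[of p A q B r C] using s by (simp add: scaleR_right_distrib)
    show ?thesis
      using s hcomb lin unfolding bary_point_def T_def x by (simp add: linear_add)
  qed
  ultimately show ?thesis by simp
qed

text \<open>
  Routh's formula: the ratio of the signed area of the inscribed triangle to that of the whole one is
  \<open>(lmn + l'm'n') / ((l + l')(m + m')(n + n'))\<close>. For the cevian triangles of \<open>P\<close> and of \<open>P'\<close> the
  numerator is \<open>2pqr\<close>.
\<close>

lemma inscribed_triangle_not_collinear:
  assumes nc: "\<not> collinear {A, B, C}"
    and s: "l + l' \<noteq> 0" "m + m' \<noteq> 0" "n + n' \<noteq> 0"
    and routh: "l * m * n + l' * m' * n' \<noteq> 0"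
  shows "\<not> collinear {weighted_point B C l l', weighted_point C A m m', weighted_point A B n n'}"
proof -
  let ?u = "B - A" and ?v = "C - A"
  have D: "weighted_point B C l l' = A + ((l / (l + l')) *\<^sub>R ?u + (l' / (l + l')) *\<^sub>R ?v)"
    and E: "weighted_point C A m m' = A + (m / (m + m')) *\<^sub>R ?v"
    and F: "weighted_point A B n n' = A + (n' / (n + n')) *\<^sub>R ?u"
    using s by (simp_all add: weighted_point_def vec_eq_iff divide_simps) (simp_all add: algebra_simps)
  have ED: "weighted_point C A m m' - weighted_point B C l l'
      = (- l / (l + l')) *\<^sub>R ?u + (m / (m + m') - l' / (l + l')) *\<^sub>R ?v"
    and FD: "weighted_point A B n n' - weighted_point B C l l'
      = (n' / (n + n') - l / (l + l')) *\<^sub>R ?u + (- l' / (l + l')) *\<^sub>R ?v"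
    unfolding D E F by (simp_all add: algebra_simps)
  have "(- l / (l + l')) * (- l' / (l + l')) - (m / (m + m') - l' / (l + l')) * (n' / (n + n') - l / (l + l'))
      = (l * m * n + l' * m' * n') / ((l + l') * (m + m') * (n + n'))"
    using s by (simp add: divide_simps) algebra
  also have "\<dots> \<noteq> 0" using s routh by simp
  finally show ?thesis
    using nc unfolding collinear_iff_wedge ED FD wedge_combination by simp
qed


lemma affine_map_taking_sides:
  assumes nc: "\<not> collinear {A, B, C}" and nc': "\<not> collinear {D, E, F}" and s: "m + n \<noteq> 0"
  defines "T \<equiv> affine_map_taking (Ordinary A, Ordinary B, Ordinary C) (Ordinary D, Ordinary E, Ordinary F)"
  shows "T (Ordinary (weighted_point B C m n)) = Ordinary (weighted_point E F m n)"
    and "T (Ordinary (weighted_point C A m n)) = Ordinary (weighted_point F D m n)"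
    and "T (Ordinary (weighted_point A B m n)) = Ordinary (weighted_point D E m n)"
  using affine_map_taking_bary_point[OF nc nc', of 0 m n] affine_map_taking_bary_point[OF nc nc', of n 0 m]
    affine_map_taking_bary_point[OF nc nc', of m n 0] s
  unfolding T_def by (simp_all add: bary_point_def weighted_point_def add.commute)

text \<open>
  The left side is \<open>A\<^sub>3 = T\<^sub>P(D\<^sub>3)\<close>, which divides \<open>EF\<close> as \<open>D\<^sub>3\<close> divides \<open>BC\<close>. Its weights at \<open>B\<close> and \<open>C\<close>
  determine the line \<open>AA\<^sub>3\<close>.
\<close>

lemma cevian_triangle_image:
  assumes s: "q + r \<noteq> 0" "r + p \<noteq> 0" "p + q \<noteq> 0"
  shows "Ordinary (weighted_point (weighted_point C A r p) (weighted_point A B p q) r q)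
    = bary_point A B C (r * p * (p + q) + p * q * (r + p)) (q\<^sup>2 * (r + p)) (r\<^sup>2 * (p + q))"
proof -
  have sum: "r * p * (p + q) + p * q * (r + p) + q\<^sup>2 * (r + p) + r\<^sup>2 * (p + q) = (q + r) * (r + p) * (p + q)"
    by algebra
  show ?thesis
    unfolding bary_point_def sum using s
    by (simp add: weighted_point_def vec_eq_iff divide_simps) (simp add: algebra_simps power2_eq_square)
qed

text \<open>
  The translation carrying \<open>A\<^sub>3B\<^sub>3C\<^sub>3\<close> to \<open>A'\<^sub>3B'\<^sub>3C'\<^sub>3\<close>. The three coefficients sum to \<open>0\<close>, so this is a
  displacement vector, and the formula is visibly cyclic.
\<close>

definition cevian_shift where
  "cevian_shift A B C p q r =
     ((q * r - p\<^sup>2) / ((r + p) * (p + q))) *\<^sub>R A + ((r * p - q\<^sup>2) / ((p + q) * (q + r))) *\<^sub>R B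
     + ((p * q - r\<^sup>2) / ((q + r) * (r + p))) *\<^sub>R (C :: real^2)"

lemma cevian_shift_cycle: "cevian_shift A B C p q r = cevian_shift B C A q r p"
  by (simp add: cevian_shift_def add_ac mult_ac)

text \<open>
  This is \<open>A\<^sub>3' = t + A\<^sub>3\<close> at one vertex. As \<open>t\<close> is cyclic, the same \<open>t\<close> serves at the other two.
\<close>

lemma reflected_image_eq_shift:
  assumes s: "q + r \<noteq> 0" "r + p \<noteq> 0" "p + q \<noteq> 0"
  shows "weighted_point (weighted_point C A p r) (weighted_point A B q p) q r
    = cevian_shift A B C p q r + weighted_point (weighted_point C A r p) (weighted_point A B p q) r q"
proof -
  have "(1 / (q + r)) * (q * ((1 / (p + r)) * (p * c + r * a)) + r * ((1 / (q + p)) * (q * a + p * b)))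
    = (q * r - p\<^sup>2) / ((r + p) * (p + q)) * a + (r * p - q\<^sup>2) / ((p + q) * (q + r)) * b
      + (p * q - r\<^sup>2) / ((q + r) * (r + p)) * c
      + (1 / (r + q)) * (r * ((1 / (r + p)) * (r * c + p * a)) + q * ((1 / (p + q)) * (p * a + q * b)))" for a b c
    using s by (simp add: divide_simps) algebra
  then show ?thesis
    by (simp add: weighted_point_def cevian_shift_def vec_eq_iff)
qed

lemma T_map_bary_point:
  assumes nc: "\<not> collinear {A, B, C}" and s: "q + r \<noteq> 0" "r + p \<noteq> 0" "p + q \<noteq> 0"
  shows "T_map A B C (bary_point A B C p q r)
      = affine_map_taking (Ordinary A, Ordinary B, Ordinary C)
          (Ordinary (weighted_point B C q r), Ordinary (weighted_point C A r p), Ordinary (weighted_point A B p q))"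
    and "T'_map A B C (bary_point A B C p q r)
      = affine_map_taking (Ordinary A, Ordinary B, Ordinary C)
          (Ordinary (weighted_point B C r q), Ordinary (weighted_point C A p r), Ordinary (weighted_point A B q p))"
proof -
  note nc2 = not_collinear_cycle[OF nc] and nc3 = not_collinear_cycle[OF not_collinear_cycle[OF nc]]
  have cyc: "bary_point A B C p q r = bary_point B C A q r p" "bary_point A B C p q r = bary_point C A B r p q"
    by (simp_all add: bary_point_cycle[of C A B] bary_point_cycle[of A B C])
  show "T_map A B C (bary_point A B C p q r)
      = affine_map_taking (Ordinary A, Ordinary B, Ordinary C)
          (Ordinary (weighted_point B C q r), Ordinary (weighted_point C A r p), Ordinary (weighted_point A B p q))"
    unfolding T_map_def
    using cevian_trace_ordinary[OF nc s(1), of p] cevian_trace_ordinary[OF nc2 s(2), of q]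
      cevian_trace_ordinary[OF nc3 s(3), of r] cyc by simp
  show "T'_map A B C (bary_point A B C p q r)
      = affine_map_taking (Ordinary A, Ordinary B, Ordinary C)
          (Ordinary (weighted_point B C r q), Ordinary (weighted_point C A p r), Ordinary (weighted_point A B q p))"
    unfolding T'_map_def
    using reflected_trace_ordinary[OF nc s(1), of p] reflected_trace_ordinary[OF nc2 s(2), of q]
      reflected_trace_ordinary[OF nc3 s(3), of r] cyc by simp
qed

section \<open>The complement map and the anticomplementary triangle\<close>

lemma complement_map_Ordinary:
  "complement_map A B C (Ordinary x) = Ordinary ((1/2) *\<^sub>R (A + B + C - x))"
  by (simp add: complement_map_def homothety_def centroid_def algebra_simps flip: scaleR_add_left)

text \<open>
  The inverse of the complement map is evaluated via injectivity on the whole extended plane; on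
  infinite points the map is the identity, since a homothety preserves directions.
\<close>

lemma anticomplementary_vertex_eq:
  assumes "V + W = A + B + C - U"
  shows "anticomplementary_vertex A B C U = Ordinary (V + W - U)"
proof -
  let ?K = "complement_map A B C"
  have dir: "extend (\<lambda>x. c + (- 1/2) *\<^sub>R (x - c)) (Infinite d) = Infinite d" for c d
  proof -
    have "subspace (Rep_direction d)" using Rep_direction[of d] by simp
    then have "(\<lambda>v. (- 1/2) *\<^sub>R v) ` Rep_direction d = Rep_direction d"
    proof (intro equalityI subsetI)
      fix v assume "v \<in> Rep_direction d"
      then have "- 2 *\<^sub>R v \<in> Rep_direction d"
        using \<open>subspace (Rep_direction d)\<close> subspace_scale by blast
      moreover have "v = (- 1/2) *\<^sub>R (- 2 *\<^sub>R v)" by simp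
      ultimately show "v \<in> (\<lambda>v. (- 1/2) *\<^sub>R v) ` Rep_direction d" by blast
    qed (auto intro: subspace_scale subspace_neg)
    then show ?thesis by (simp add: algebra_simps Rep_direction_inverse)
  qed
  have "inj ?K"
  proof (rule injI)
    fix Y Z assume "?K Y = ?K Z"
    moreover have "?K (Infinite d) = Infinite d" for d
      using dir by (simp add: complement_map_def homothety_def)
    ultimately show "Y = Z"
      by (cases Y; cases Z) (auto simp: complement_map_Ordinary)
  qed
  moreover have "?K (Ordinary (V + W - U)) = Ordinary U"
    using assms by (simp add: complement_map_Ordinary vec_eq_iff)
  ultimately show ?thesis
    unfolding anticomplementary_vertex_def by (rule inv_f_eq)
qed

text \<open>
  Change of coordinates to the anticomplementary triangle: it reduces the condition on the
  anticomplementary sides to the one on the sides of a triangle.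
\<close>

lemma bary_point_anticomplementary:
  "bary_point A B C p q r = bary_point (B + C - A) (C + A - B) (A + B - C) (q + r) (r + p) (p + q)"
proof -
  have sum: "(q + r) + (r + p) + (p + q) = 2 * (p + q + r)" by simp
  have vec: "(q + r) *\<^sub>R (B + C - A) + (r + p) *\<^sub>R (C + A - B) + (p + q) *\<^sub>R (A + B - C)
    = 2 *\<^sub>R (p *\<^sub>R A + q *\<^sub>R B + r *\<^sub>R C)"
    by (simp add: vec_eq_iff) (simp add: algebra_simps)
  have dir: "direction_of (2 *\<^sub>R v) = direction_of v" for v
    using direction_of_eqI[of "2 *\<^sub>R v" 2 v] by (cases "v = 0") auto
  show ?thesis
    unfolding bary_point_def sum vec dir by (simp del: distrib_left_numeral)
qed

lemma anticomplementary_not_collinear: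
  fixes A B C :: "real^2"
  assumes "\<not> collinear {A, B, C}"
  shows "\<not> collinear {B + C - A, C + A - B, A + B - C}"
proof -
  have "C + A - B - (B + C - A) = (- 2) *\<^sub>R (B - A) + 0 *\<^sub>R (C - A)"
    "A + B - C - (B + C - A) = 0 *\<^sub>R (B - A) + (- 2) *\<^sub>R (C - A)"
    by (simp_all add: vec_eq_iff)
  then show ?thesis
    using assms unfolding collinear_iff_wedge by (simp only: wedge_combination) simp
qed

lemma bary_point_off_side_lines:
  assumes nc: "\<not> collinear {A, B, C}" and pqr: "p \<noteq> 0 \<or> q \<noteq> 0 \<or> r \<noteq> 0"
    and off: "bary_point A B C p q r \<notin> side_lines (Ordinary A) (Ordinary B) (Ordinary C)"
  shows "p \<noteq> 0" "q \<noteq> 0" "r \<noteq> 0"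
proof -
  note nc2 = not_collinear_cycle[OF nc] and nc3 = not_collinear_cycle[OF not_collinear_cycle[OF nc]]
  have cyc: "bary_point A B C p q r = bary_point B C A q r p" "bary_point A B C p q r = bary_point C A B r p q"
    by (simp_all add: bary_point_cycle[of C A B] bary_point_cycle[of A B C])
  show "p \<noteq> 0" "q \<noteq> 0" "r \<noteq> 0"
    using off bary_point_on_side[OF nc, of p q r] bary_point_on_side[OF nc2, of q r p]
      bary_point_on_side[OF nc3, of r p q] pqr cyc
    unfolding side_lines_def by auto
qed

section \<open>Displacements along the line from the centroid to the point\<close>

text \<open>
  By \<open>cevian_triangle_image\<close>, \<open>A\<^sub>3\<close> and \<open>B\<^sub>3\<close> share with the point on the right the weights away from
  \<open>A\<close> and away from \<open>B\<close>, respectively.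
\<close>

lemma X_point_bary_point:
  assumes nc: "\<not> collinear {A, B, C}"
    and nz: "p \<noteq> 0" "q \<noteq> 0" "r \<noteq> 0" "q + r \<noteq> 0" "r + p \<noteq> 0" "p + q \<noteq> 0"
    and TA: "T_map A B C P (reflected_trace A B C P)
      = Ordinary (weighted_point (weighted_point C A r p) (weighted_point A B p q) r q)"
    and TB: "T_map A B C P (reflected_trace B C A P)
      = Ordinary (weighted_point (weighted_point A B p q) (weighted_point B C q r) p r)"
  shows "X_point A B C P = bary_point A B C (p\<^sup>2 * (q + r)) (q\<^sup>2 * (r + p)) (r\<^sup>2 * (p + q))"
proof -
  have A: "T_map A B C P (reflected_trace A B C P)
     = bary_point A B C (r * p * (p + q) + p * q * (r + p)) (q\<^sup>2 * (r + p)) (r\<^sup>2 * (p + q))"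
    unfolding TA by (rule cevian_triangle_image) (use nz in auto)
  have B: "T_map A B C P (reflected_trace B C A P)
     = bary_point A B C (p\<^sup>2 * (q + r)) (p * q * (q + r) + q * r * (p + q)) (r\<^sup>2 * (p + q))"
    unfolding TB bary_point_cycle[of A B C] by (rule cevian_triangle_image) (use nz in auto)
  have "r\<^sup>2 * (p + q) \<noteq> 0" using nz by simp
  then show ?thesis
    unfolding X_point_def A B meet_def using cevians_meet_iff[OF nc] by simp
qed

text \<open>
  The coefficient of \<open>A\<close> in \<open>T_image_displacement\<close>. With \<open>\<sigma> = qr + rp + pq\<close> and \<open>p + q + r = 1\<close>,
  both sides equal \<open>qr (p - \<sigma>) p / (\<sigma> (r + p)(p + q))\<close>.
\<close>

lemma T_image_coefficient:
  fixes p q r :: real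
  assumes sum: "p + q + r = 1" and nz: "q + r \<noteq> 0" "r + p \<noteq> 0" "p + q \<noteq> 0"
    and \<sigma>: "q * r + r * p + p * q \<noteq> 0"
  shows "(r * p * (p / (r + p)) + p * q * (p / (p + q))) / (q * r + r * p + p * q) - p
     = (p * q * r / ((q + r) * (r + p) * (p + q))) * (p - q * r / (q * r + r * p + p * q))"
  using assms by (simp add: divide_simps) algebra

lemma combination_difference:
  fixes A B C :: "real^2"
  assumes "a / s - a' = k * (b - b')" "c / s - c' = k * (d - d')" "e / s - e' = k * (f - f')"
  shows "(1 / s) *\<^sub>R (a *\<^sub>R A + c *\<^sub>R B + e *\<^sub>R C) - (a' *\<^sub>R A + c' *\<^sub>R B + e' *\<^sub>R C)
    = k *\<^sub>R ((b *\<^sub>R A + d *\<^sub>R B + f *\<^sub>R C) - (b' *\<^sub>R A + d' *\<^sub>R B + f' *\<^sub>R C))"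
proof -
  have "(1 / s) *\<^sub>R (a *\<^sub>R A + c *\<^sub>R B + e *\<^sub>R C) - (a' *\<^sub>R A + c' *\<^sub>R B + e' *\<^sub>R C)
    = (a / s - a') *\<^sub>R A + (c / s - c') *\<^sub>R B + (e / s - e') *\<^sub>R C"
    by (simp add: algebra_simps)
  then show ?thesis unfolding assms by (simp add: algebra_simps)
qed

text \<open>
  \<open>P'\<close> has weights \<open>(qr, rp, pq)\<close>, so its image under \<open>T\<^sub>P\<close> has the same weights with respect to \<open>DEF\<close>.
  Re-expanding in \<open>A\<close>, \<open>B\<close>, \<open>C\<close> leaves one coefficient identity and its cyclic images.
\<close>

lemma T_image_displacement:
  fixes A B C :: "real^2"
  assumes sum: "p + q + r = 1" and nz: "q + r \<noteq> 0" "r + p \<noteq> 0" "p + q \<noteq> 0"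
    and \<sigma>: "q * r + r * p + p * q \<noteq> 0"
  defines "S \<equiv> p *\<^sub>R A + q *\<^sub>R B + r *\<^sub>R C"
    and "S' \<equiv> (1 / (q * r + r * p + p * q)) *\<^sub>R ((q * r) *\<^sub>R A + (r * p) *\<^sub>R B + (p * q) *\<^sub>R C)"
  shows "(1 / (q * r + r * p + p * q)) *\<^sub>R ((q * r) *\<^sub>R weighted_point B C q r
        + (r * p) *\<^sub>R weighted_point C A r p + (p * q) *\<^sub>R weighted_point A B p q) - S
    = (p * q * r / ((q + r) * (r + p) * (p + q))) *\<^sub>R (S - S')"
proof -
  let ?\<sigma> = "q * r + r * p + p * q" and ?\<Pi> = "(q + r) * (r + p) * (p + q)"
  have vec: "(q * r) *\<^sub>R weighted_point B C q r
        + (r * p) *\<^sub>R weighted_point C A r p + (p * q) *\<^sub>R weighted_point A B p q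
      = (r * p * (p / (r + p)) + p * q * (p / (p + q))) *\<^sub>R A
      + (p * q * (q / (p + q)) + q * r * (q / (q + r))) *\<^sub>R B
      + (q * r * (r / (q + r)) + r * p * (r / (r + p))) *\<^sub>R C"
    by (simp add: weighted_point_def vec_eq_iff add_divide_distrib algebra_simps)
  have S': "S' = (q * r / ?\<sigma>) *\<^sub>R A + (r * p / ?\<sigma>) *\<^sub>R B + (p * q / ?\<sigma>) *\<^sub>R C"
    by (simp add: S'_def scaleR_right_distrib)
  show ?thesis
    unfolding vec S' S_def
  proof (rule combination_difference)
    show "(r * p * (p / (r + p)) + p * q * (p / (p + q))) / ?\<sigma> - p = p * q * r / ?\<Pi> * (p - q * r / ?\<sigma>)"
      using T_image_coefficient[of p q r] assms by blast
    show "(p * q * (q / (p + q)) + q * r * (q / (q + r))) / ?\<sigma> - q = p * q * r / ?\<Pi> * (q - r * p / ?\<sigma>)"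
      using T_image_coefficient[of q r p] sum nz \<sigma> by (simp add: ac_simps)
    show "(q * r * (r / (q + r)) + r * p * (r / (r + p))) / ?\<sigma> - r = p * q * r / ?\<Pi> * (r - p * q / ?\<sigma>)"
      using T_image_coefficient[of r p q] sum nz \<sigma> by (simp add: ac_simps)
  qed
qed

text \<open>
  The points \<open>X\<close>, \<open>P\<close>, \<open>G\<close> and \<open>Q'\<close> are collinear: the coefficient of \<open>A\<close> in either displacement is
  \<open>p - 1/3\<close> times a factor symmetric in \<open>p\<close>, \<open>q\<close>, \<open>r\<close>.
\<close>

lemma X_displacement:
  fixes A B C :: "real^2"
  assumes sum: "p + q + r = 1"
  defines "N \<equiv> p\<^sup>2 * (q + r) + q\<^sup>2 * (r + p) + r\<^sup>2 * (p + q)"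
    and "S \<equiv> p *\<^sub>R A + q *\<^sub>R B + r *\<^sub>R C"
    and "G \<equiv> (1/3) *\<^sub>R A + (1/3) *\<^sub>R B + (1/3) *\<^sub>R C"
  defines "Y \<equiv> (1 / N) *\<^sub>R ((p\<^sup>2 * (q + r)) *\<^sub>R A + (q\<^sup>2 * (r + p)) *\<^sub>R B + (r\<^sup>2 * (p + q)) *\<^sub>R C)"
  assumes N: "N \<noteq> 0"
  shows "Y - S = (3 * p * q * r / N) *\<^sub>R (S - G)"
    and "Y - (1/2) *\<^sub>R (A + B + C - S) = (3 * ((q + r) * (r + p) * (p + q)) / (2 * N)) *\<^sub>R (S - G)"
proof -
  have to_P: "x\<^sup>2 * (y + z) / M - x = 3 * x * y * z / M * (x - 1/3)"
    and to_Q': "x\<^sup>2 * (y + z) / M - (1 - x) / 2 = 3 * ((y + z) * (z + x) * (x + y)) / (2 * M) * (x - 1/3)"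
    if "M = x\<^sup>2 * (y + z) + y\<^sup>2 * (z + x) + z\<^sup>2 * (x + y)" "M \<noteq> 0" "x + y + z = 1" for x y z M :: real
  proof -
    have z: "z = 1 - x - y" using that by simp
    show "x\<^sup>2 * (y + z) / M - x = 3 * x * y * z / M * (x - 1/3)"
      using that(2) unfolding z
      by (simp add: divide_simps) (simp add: that(1) z algebra_simps power2_eq_square)
    show "x\<^sup>2 * (y + z) / M - (1 - x) / 2 = 3 * ((y + z) * (z + x) * (x + y)) / (2 * M) * (x - 1/3)"
      using that(2) unfolding z
      by (simp add: divide_simps) (simp add: that(1) z algebra_simps power2_eq_square)
  qed
  have N': "N = q\<^sup>2 * (r + p) + r\<^sup>2 * (p + q) + p\<^sup>2 * (q + r)" "N = r\<^sup>2 * (p + q) + p\<^sup>2 * (q + r) + q\<^sup>2 * (r + p)"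
    by (simp_all add: N_def)
  have sum': "q + r + p = 1" "r + p + q = 1" using sum by simp_all
  show "Y - S = (3 * p * q * r / N) *\<^sub>R (S - G)"
    unfolding Y_def S_def G_def
    using to_P[OF meta_eq_to_obj_eq[OF N_def] N sum] to_P[OF N'(1) N sum'(1)] to_P[OF N'(2) N sum'(2)]
    by (intro combination_difference) (simp_all add: ac_simps)
  have Q': "(1/2) *\<^sub>R (A + B + C - S) = ((1 - p) / 2) *\<^sub>R A + ((1 - q) / 2) *\<^sub>R B + ((1 - r) / 2) *\<^sub>R C"
    by (simp add: S_def vec_eq_iff field_simps)
  show "Y - (1/2) *\<^sub>R (A + B + C - S) = (3 * ((q + r) * (r + p) * (p + q)) / (2 * N)) *\<^sub>R (S - G)"
    unfolding Q' unfolding Y_def S_def G_def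
    using to_Q'[OF meta_eq_to_obj_eq[OF N_def] N sum] to_Q'[OF N'(1) N sum'(1)] to_Q'[OF N'(2) N sum'(2)]
    by (intro combination_difference) (simp_all add: ac_simps)
qed

lemma congruent_triangles_translate:
  assumes "\<not> collinear {x, y, z}"
  shows "congruent_triangles (Ordinary x, Ordinary y, Ordinary z)
    (Ordinary (t + x), Ordinary (t + y), Ordinary (t + z))"
  unfolding congruent_triangles_def using assms
  by (intro exI[of _ x] exI[of _ y] exI[of _ z] exI[of _ "(+) t"]) simp

section \<open>The congruence and the length formula\<close>

theorem corollary2p8:
  fixes A B C :: "real^2"
    and P P' Q Q' X D E F D3 E3 F3 A3 B3 C3 A3' B3' C3' :: point
  assumes triangle: "\<not> collinear {A, B, C}"
    and not_on_sides: "P \<notin> side_lines (Ordinary A) (Ordinary B) (Ordinary C)"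
    and not_on_anticomplementary_sides:
      "P \<notin> side_lines (anticomplementary_vertex A B C A)
                      (anticomplementary_vertex A B C B)
                      (anticomplementary_vertex A B C C)"
    and P': "P' = isotomic_conjugate A B C P"
    and Q: "Q = complement_map A B C P'" and Q': "Q' = complement_map A B C P"
    and D: "D = cevian_trace A B C P" and E: "E = cevian_trace B C A P" and F: "F = cevian_trace C A B P"
    and D3: "D3 = reflected_trace A B C P"
    and E3: "E3 = reflected_trace B C A P"
    and F3: "F3 = reflected_trace C A B P"
    and A3: "A3 = T_map A B C P D3" and B3: "B3 = T_map A B C P E3"
    and C3: "C3 = T_map A B C P F3"
    and A3': "A3' = T'_map A B C P D" and B3': "B3' = T'_map A B C P E"
    and C3': "C3' = T'_map A B C P F"
    and X: "X = X_point A B C P"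
  shows "congruent_triangles (A3, B3, C3) (A3', B3', C3') \<and>
    (is_ordinary P \<and> is_ordinary P' \<longrightarrow>
       is_ordinary (T_map A B C P P') \<and>
       (if is_ordinary X
        then seg_length (T_map A B C P P') P = seg_length Q Q' * seg_length X P / seg_length X Q'
        else \<comment> \<open>\<open>X\<close> infinite: the quotient \<open>|XP| / |XQ'|\<close> has the limiting value 1\<close>
             seg_length (T_map A B C P P') P = seg_length Q Q'))"
proof -
  note nc = triangle
  note nc2 = not_collinear_cycle[OF nc] and nc3 = not_collinear_cycle[OF not_collinear_cycle[OF nc]]
  \<comment> \<open>For ordinary \<open>P\<close> the weights are normalised once and for all, as part (b) requires.\<close>
  obtain p q r where P: "P = bary_point A B C p q r" and pqr: "p \<noteq> 0 \<or> q \<noteq> 0 \<or> r \<noteq> 0"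
    and normal: "is_ordinary P \<longrightarrow> p + q + r = 1"
  proof -
    obtain p q r where P: "P = bary_point A B C p q r" and pqr: "p \<noteq> 0 \<or> q \<noteq> 0 \<or> r \<noteq> 0"
      using bary_point_exists[OF nc] by blast
    show thesis
    proof (cases "p + q + r = 0")
      case True
      then show thesis using that[OF P pqr] by (simp add: P bary_point_def is_ordinary_def)
    next
      case False
      let ?k = "1 / (p + q + r)"
      have "P = bary_point A B C (?k * p) (?k * q) (?k * r)"
        unfolding P using False by (intro bary_point_scale[symmetric]) auto
      moreover have "?k * p + ?k * q + ?k * r = 1"
        using False by (simp flip: add_divide_distrib)
      ultimately show thesis using that[of "?k * p" "?k * q" "?k * r"] pqr False by auto
    qed
  qed
  have nz: "p \<noteq> 0" "q \<noteq> 0" "r \<noteq> 0"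
    using bary_point_off_side_lines[OF nc pqr] not_on_sides P by blast+
  have s: "q + r \<noteq> 0" "r + p \<noteq> 0" "p + q \<noteq> 0"
  proof -
    have "anticomplementary_vertex A B C A = Ordinary (B + C - A)"
      "anticomplementary_vertex A B C B = Ordinary (C + A - B)"
      "anticomplementary_vertex A B C C = Ordinary (A + B - C)"
      by (intro anticomplementary_vertex_eq; simp add: algebra_simps)+
    moreover have "q + r \<noteq> 0 \<or> r + p \<noteq> 0 \<or> p + q \<noteq> 0" using nz by linarith
    ultimately show "q + r \<noteq> 0" "r + p \<noteq> 0" "p + q \<noteq> 0"
      using bary_point_off_side_lines[OF anticomplementary_not_collinear[OF nc], of "q + r" "r + p" "p + q"]
        not_on_anticomplementary_sides
      by (simp_all add: P bary_point_anticomplementary[of A B C p q r])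
  qed
  then have s': "r + q \<noteq> 0" "p + r \<noteq> 0" "q + p \<noteq> 0" by (simp_all add: add.commute)
  define d e f where "d = weighted_point B C q r" and "e = weighted_point C A r p" and "f = weighted_point A B p q"
  define d' e' f' where "d' = weighted_point B C r q" and "e' = weighted_point C A p r" and "f' = weighted_point A B q p"
  note defs = d_def e_def f_def d'_def e'_def f'_def
  have cyc: "P = bary_point B C A q r p" "P = bary_point C A B r p q"
    by (simp_all add: P bary_point_cycle[of C A B] bary_point_cycle[of A B C])
  have traces: "D = Ordinary d" "E = Ordinary e" "F = Ordinary f"
    "D3 = Ordinary d'" "E3 = Ordinary e'" "F3 = Ordinary f'"
    unfolding D E F D3 E3 F3 defs
    using cevian_trace_ordinary[OF nc s(1)] cevian_trace_ordinary[OF nc2 s(2)] cevian_trace_ordinary[OF nc3 s(3)]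
      reflected_trace_ordinary[OF nc s(1)] reflected_trace_ordinary[OF nc2 s(2)] reflected_trace_ordinary[OF nc3 s(3)]
      P cyc by metis+
  have T: "T_map A B C P = affine_map_taking (Ordinary A, Ordinary B, Ordinary C) (Ordinary d, Ordinary e, Ordinary f)"
    and T': "T'_map A B C P = affine_map_taking (Ordinary A, Ordinary B, Ordinary C) (Ordinary d', Ordinary e', Ordinary f')"
    unfolding P defs by (rule T_map_bary_point[OF nc s])+
  have "q * r * p + r * p * q \<noteq> 0" "r * p * q + q * r * p \<noteq> 0" using nz by simp_all
  then have nc_def: "\<not> collinear {d, e, f}" and nc_def': "\<not> collinear {d', e', f'}"
    unfolding defs using inscribed_triangle_not_collinear[OF nc s] inscribed_triangle_not_collinear[OF nc s']
    by blast+
  have A3s: "A3 = Ordinary (weighted_point e f r q)" "B3 = Ordinary (weighted_point f d p r)"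
    "C3 = Ordinary (weighted_point d e q p)"
    unfolding A3 B3 C3 traces T
    using affine_map_taking_sides[OF nc nc_def] s' unfolding d'_def e'_def f'_def by blast+
  have A3's: "A3' = Ordinary (weighted_point e' f' q r)" "B3' = Ordinary (weighted_point f' d' r p)"
    "C3' = Ordinary (weighted_point d' e' p q)"
    unfolding A3' B3' C3' traces T'
    using affine_map_taking_sides[OF nc nc_def'] s unfolding d_def e_def f_def by blast+
  have congruent: "congruent_triangles (A3, B3, C3) (A3', B3', C3')"
  proof -
    let ?t = "cevian_shift A B C p q r"
    have t: "?t = cevian_shift B C A q r p" "?t = cevian_shift C A B r p q"
      by (simp_all add: cevian_shift_cycle[of C A B] cevian_shift_cycle[of A B C])
    have shift: "weighted_point e' f' q r = ?t + weighted_point e f r q"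
      "weighted_point f' d' r p = ?t + weighted_point f d p r"
      "weighted_point d' e' p q = ?t + weighted_point d e q p"
      unfolding defs using reflected_image_eq_shift[OF s] reflected_image_eq_shift[OF s(2,3,1)]
        reflected_image_eq_shift[OF s(3,1,2)] t by simp_all
    have "r * p * q + q * r * p \<noteq> 0" using nz by simp
    then have "\<not> collinear {weighted_point e f r q, weighted_point f d p r, weighted_point d e q p}"
      using inscribed_triangle_not_collinear[OF nc_def s'] by blast
    then show ?thesis unfolding A3s A3's shift by (rule congruent_triangles_translate)
  qed
  have len: "is_ordinary (T_map A B C P P') \<and>
       (if is_ordinary X
        then seg_length (T_map A B C P P') P = seg_length Q Q' * seg_length X P / seg_length X Q'
        else seg_length (T_map A B C P P') P = seg_length Q Q')"
    if ord: "is_ordinary P" "is_ordinary P'"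
  proof -
    have sum: "p + q + r = 1" using ord normal by blast
    let ?\<sigma> = "q * r + r * p + p * q" and ?\<Pi> = "(q + r) * (r + p) * (p + q)"
    let ?N = "p\<^sup>2 * (q + r) + q\<^sup>2 * (r + p) + r\<^sup>2 * (p + q)"
    have P'_bary: "P' = bary_point A B C (q * r) (r * p) (p * q)"
      unfolding P' P by (rule isotomic_conjugate_bary_point[OF nc nz s])
    then have \<sigma>: "?\<sigma> \<noteq> 0" using ord by (auto simp: bary_point_def is_ordinary_def split: if_splits)
    define S where "S = p *\<^sub>R A + q *\<^sub>R B + r *\<^sub>R C"
    define S' where "S' = (1 / ?\<sigma>) *\<^sub>R ((q * r) *\<^sub>R A + (r * p) *\<^sub>R B + (p * q) *\<^sub>R C)"
    define G where "G = (1/3) *\<^sub>R A + (1/3) *\<^sub>R B + (1/3) *\<^sub>R C"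
    define t where "t = (1 / ?\<sigma>) *\<^sub>R ((q * r) *\<^sub>R d + (r * p) *\<^sub>R e + (p * q) *\<^sub>R f)"
    define k where "k = p * q * r / ?\<Pi>"
    have PS: "P = Ordinary S" by (simp add: P bary_point_def S_def sum)
    have P'S': "P' = Ordinary S'" using \<sigma> by (simp add: P'_bary bary_point_def S'_def)
    have TP': "T_map A B C P P' = Ordinary t"
      unfolding T P'_bary affine_map_taking_bary_point[OF nc nc_def \<sigma>]
      using \<sigma> by (simp add: bary_point_def t_def)
    have QQ': "Q = Ordinary ((1/2) *\<^sub>R (A + B + C - S'))" "Q' = Ordinary ((1/2) *\<^sub>R (A + B + C - S))"
      unfolding Q Q' PS P'S' complement_map_Ordinary by simp_all
    have "t - S = k *\<^sub>R (S - S')"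
      unfolding t_def S_def S'_def k_def d_def e_def f_def by (rule T_image_displacement[OF sum s \<sigma>])
    then have tS: "seg_length (Ordinary t) P = \<bar>k\<bar> * norm (S - S')"
      unfolding PS by (simp add: dist_norm)
    have "(1/2) *\<^sub>R (A + B + C - S') - (1/2) *\<^sub>R (A + B + C - S) = (1/2) *\<^sub>R (S - S')"
      by (simp add: algebra_simps)
    then have QQ'_length: "seg_length Q Q' = norm (S - S') / 2"
      unfolding QQ' by (simp add: dist_norm)
    have "X = bary_point A B C (p\<^sup>2 * (q + r)) (q\<^sup>2 * (r + p)) (r\<^sup>2 * (p + q))"
      unfolding X using A3 B3 A3s D3 E3 by (intro X_point_bary_point[OF nc nz s]) (simp_all add: defs)
    then have X_bary: "X = (if ?N = 0 then Infinite (direction_of ((p\<^sup>2 * (q + r)) *\<^sub>R A + (q\<^sup>2 * (r + p)) *\<^sub>R B + (r\<^sup>2 * (p + q)) *\<^sub>R C))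
       else Ordinary ((1 / ?N) *\<^sub>R ((p\<^sup>2 * (q + r)) *\<^sub>R A + (q\<^sup>2 * (r + p)) *\<^sub>R B + (r\<^sup>2 * (p + q)) *\<^sub>R C)))"
      unfolding bary_point_def .
    show ?thesis
    proof (cases "?N = 0")
      case True
      have "?\<Pi> = ?N + 2 * (p * q * r)" by algebra
      then have "k = 1 / 2" using nz True by (simp add: k_def)
      then show ?thesis using True unfolding TP' tS QQ'_length by (simp add: X_bary is_ordinary_def)
    next
      case False
      define Y where "Y = (1 / ?N) *\<^sub>R ((p\<^sup>2 * (q + r)) *\<^sub>R A + (q\<^sup>2 * (r + p)) *\<^sub>R B + (r\<^sup>2 * (p + q)) *\<^sub>R C)"
      have XY: "X = Ordinary Y" using False by (simp add: X_bary Y_def)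
      note disp = X_displacement[OF sum False, of A B C, folded S_def G_def Y_def]
      have XP: "seg_length X P = \<bar>3 * p * q * r / ?N\<bar> * norm (S - G)"
        using disp(1) by (simp add: XY PS dist_norm)
      have XQ': "seg_length X Q' = \<bar>3 * ?\<Pi> / (2 * ?N)\<bar> * norm (S - G)"
        using disp(2) unfolding XY QQ' by (simp add: dist_norm)
      have "\<bar>k\<bar> * norm (S - S') = norm (S - S') / 2 * seg_length X P / seg_length X Q'"
      proof (cases "S = G")
        \<comment> \<open>Here \<open>X = Q' = P\<close>, so the quotient is \<open>0 / 0 = 0\<close>; the left side vanishes because the centroid
          is its own isotomic conjugate.\<close>
        case True
        have w: "wedge (B - A) (C - A) \<noteq> 0" using nc collinear_iff_wedge by blast
        have "(q - 1/3) *\<^sub>R (B - A) + (r - 1/3) *\<^sub>R (C - A) = S - G - (p + q + r - 1) *\<^sub>R A"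
          by (simp add: S_def G_def vec_eq_iff algebra_simps)
        also have "\<dots> = 0" using True sum by simp
        finally have "q = 1/3 \<and> r = 1/3" using combination_eq_0_iff[OF w] by simp
        then have thirds: "p = 1/3" "q = 1/3" "r = 1/3" using sum by auto
        have "S' = S"
          unfolding S_def S'_def thirds by (simp add: vec_eq_iff)
        then show ?thesis by simp
      next
        case False
        then have "norm (S - G) \<noteq> 0" by simp
        moreover have "\<bar>3 * p * q * r / ?N\<bar> = 2 * \<bar>k\<bar> * \<bar>3 * ?\<Pi> / (2 * ?N)\<bar>"
        proof -
          have "3 * p * q * r / n = 2 * (p * q * r / c) * (3 * c / (2 * n))" if "c \<noteq> 0" for c n :: real
            using that by simp
          from this[of ?\<Pi> ?N] have "3 * p * q * r / ?N = 2 * k * (3 * ?\<Pi> / (2 * ?N))"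
            using s unfolding k_def by simp
          then show ?thesis by (simp only: abs_mult abs_numeral)
        qed
        moreover have "\<bar>3 * ?\<Pi> / (2 * ?N)\<bar> \<noteq> 0" using s \<open>?N \<noteq> 0\<close> by simp
        ultimately show ?thesis unfolding XP XQ' by simp
      qed
      then show ?thesis unfolding TP' tS QQ'_length by (simp add: XY is_ordinary_def)
    qed
  qed
  show ?thesis using congruent len by blast
qed

end
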